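(* Let $\mathcal{H}$ be an infinite dimensional separable complex Hilbert space and let $m\geq 1$ be an integer. A Drazin invertible operator $T\in B(\mathcal{H}_1\oplus\mathcal{H}_2)$, $\mathcal{H}=\mathcal{H}_1\oplus\mathcal{H}_2$, with Drazin inverse $T_d$ is $(m,P)$-expansive for some positive operator $P\in B(\mathcal{H})$ if and only if $P=P_{11}\oplus 0\in B(\mathcal{H}_1\oplus\mathcal{H}_2)$ and $\tilde\triangle^m_{T_d^*,T_d}(P)\leq 0$.
   Context: $B(\mathcal{H})$ is the algebra of operators on $\mathcal{H}$, with identity $I$. "Positive" means $P\geq 0$ (non-negative). $T\in B(\mathcal{H})$ is Drazin invertible, with Drazin inverse $T_d\in B(\mathcal{H})$, if $TT_d=T_dT$, $T_d^2T=T_d$ and $T^{p+1}T_d=T^p$ for some integer $p\geq 1$. For such $T$ there is, for some positive integer $p$, a direct sum decomposition $\mathcal{H}=T^p(\mathcal{H})\oplus\ker(T^p)=\mathcal{H}_1\oplus\mathcal{H}_2$, with respect to which $T=T|_{\mathcal{H}_1}\oplus T|_{\mathcal{H}_2}=T_1\oplus T_2$, where $T_1$ is invertible and $T_2$ is $p$-nilpotent ($T_2^p=0$), and $T_d=T_1^{-1}\oplus 0$; $\mathcal{H}_1$ and $\mathcal{H}_2$ in the claim are these subspaces, and $P_{11}$ is an operator in $B(\mathcal{H}_1)$. For $S,X\in B(\mathcal{H})$, $$\triangle^m_{S^*,S}(X)=\sum_{j=0}^m(-1)^j\binom{m}{j}S^{*j}XS^j,\qquad \tilde\triangle^m_{S^*,S}(X)=(-1)^m\triangle^m_{S^*,S}(X).$$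 $T$ is $(m,P)$-expansive if $\triangle^m_{T^*,T}(P)\leq 0$.
   Formalization: Read for each given positive P. As an operator identity P = P11 ⊕ 0 can fail if H1, H2 are not orthogonal, so it is claimed for H1 ⊥ H2; for general T it is replaced by ⟨P(x+y), u+v⟩ = ⟨P11 x, u⟩ for x, u in H1 and y, v in H2. *)

theory Defs
  imports "HOL-Analysis.Analysis"
begin

text \<open>
  A complex Hilbert space is a complete real inner product space with a compatible complex
  structure: the real inner product is the real part of the complex one, so norm, topology and
  real-linear boundedness are those of the library.  The complex inner product is linear in its
  first argument.
\<close>

class complex_hilbert_space = real_inner + complete_space +
  fixes scaleC :: "complex \<Rightarrow> 'a \<Rightarrow> 'a" (infixr "*\<^sub>C" 75)
    and cinner :: "'a \<Rightarrow> 'a \<Rightarrow> complex"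
  assumes scaleC_add_right: "c *\<^sub>C (x + y) = c *\<^sub>C x + c *\<^sub>C y"
    and scaleC_add_left: "(c + d) *\<^sub>C x = c *\<^sub>C x + d *\<^sub>C x"
    and scaleC_scaleC: "c *\<^sub>C d *\<^sub>C x = (c * d) *\<^sub>C x"
    and scaleC_of_real: "complex_of_real r *\<^sub>C x = r *\<^sub>R x"
    and cinner_commute: "cinner x y = cnj (cinner y x)"
    and cinner_add_left: "cinner (x + y) z = cinner x z + cinner y z"
    and cinner_scaleC_left: "cinner (c *\<^sub>C x) y = c * cinner x y"
    and Re_cinner: "Re (cinner x y) = inner x y"

interpretation complex_vector: vector_space
  "scaleC :: complex \<Rightarrow> 'h \<Rightarrow> 'h::complex_hilbert_space"
proof
  fix a b :: complex and x y :: 'h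
  show "1 *\<^sub>C x = x"
    using scaleC_of_real[of 1 x] by simp
qed (simp_all add: scaleC_add_right scaleC_add_left scaleC_scaleC)

definition bounded_clinear :: "('h::complex_hilbert_space \<Rightarrow> 'h) \<Rightarrow> bool" where
  "bounded_clinear T \<longleftrightarrow> bounded_linear T \<and> (\<forall>c x. T (c *\<^sub>C x) = c *\<^sub>C T x)"

text \<open>The elements of $B(M)$ for a subspace $M$; values outside $M$ are irrelevant.\<close>

definition bounded_clinear_on ::
    "'h::complex_hilbert_space set \<Rightarrow> ('h \<Rightarrow> 'h) \<Rightarrow> bool" where
  "bounded_clinear_on M A \<longleftrightarrow>
     (\<forall>x\<in>M. A x \<in> M) \<and>
     (\<forall>x\<in>M. \<forall>y\<in>M. A (x + y) = A x + A y) \<and>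
     (\<forall>c. \<forall>x\<in>M. A (c *\<^sub>C x) = c *\<^sub>C A x) \<and>
     (\<exists>K. \<forall>x\<in>M. norm (A x) \<le> K * norm x)"

text \<open>For bounded complex-linear \<open>T\<close> the adjoint exists and is unique (Riesz).\<close>

definition cadjoint :: "('h::complex_hilbert_space \<Rightarrow> 'h) \<Rightarrow> 'h \<Rightarrow> 'h" where
  "cadjoint T = (THE S. \<forall>x y. cinner (T x) y = cinner x (S y))"

definition op_le :: "('h::complex_hilbert_space \<Rightarrow> 'h) \<Rightarrow> ('h \<Rightarrow> 'h) \<Rightarrow> bool" where
  "op_le A B \<longleftrightarrow> (\<forall>x. cinner (B x - A x) x \<in> \<real> \<and> 0 \<le> Re (cinner (B x - A x) x))"

definition positive_operator :: "('h::complex_hilbert_space \<Rightarrow> 'h) \<Rightarrow> bool" where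
  "positive_operator P \<longleftrightarrow> bounded_clinear P \<and> op_le (\<lambda>_. 0) P"

definition Delta ::
    "nat \<Rightarrow> ('h::complex_hilbert_space \<Rightarrow> 'h) \<Rightarrow> ('h \<Rightarrow> 'h) \<Rightarrow> 'h \<Rightarrow> 'h" where
  "Delta m S X = (\<lambda>x. \<Sum>j\<le>m. ((-1) ^ j * real (m choose j)) *\<^sub>R
     (cadjoint S ^^ j) (X ((S ^^ j) x)))"

definition Delta_tilde ::
    "nat \<Rightarrow> ('h::complex_hilbert_space \<Rightarrow> 'h) \<Rightarrow> ('h \<Rightarrow> 'h) \<Rightarrow> 'h \<Rightarrow> 'h" where
  "Delta_tilde m S X = (\<lambda>x. (-1) ^ m *\<^sub>R Delta m S X x)"

definition expansive ::
    "nat \<Rightarrow> ('h::complex_hilbert_space \<Rightarrow> 'h) \<Rightarrow> ('h \<Rightarrow> 'h) \<Rightarrow> bool" where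
  "expansive m P T \<longleftrightarrow> op_le (Delta m T P) (\<lambda>_. 0)"

text \<open>
  \<open>S\<close> is the Drazin inverse of \<open>T\<close>, and \<open>p\<close> is an exponent witnessing this (not necessarily the
  least one; \<open>drazin_range\<close> and \<open>drazin_kernel\<close> below do not depend on the choice).
\<close>

definition drazin_inverse ::
    "nat \<Rightarrow> ('h::complex_hilbert_space \<Rightarrow> 'h) \<Rightarrow> ('h \<Rightarrow> 'h) \<Rightarrow> bool" where
  "drazin_inverse p T S \<longleftrightarrow> bounded_clinear T \<and> bounded_clinear S \<and> p \<ge> 1 \<and>
     T \<circ> S = S \<circ> T \<and> (S ^^ 2) \<circ> T = S \<and> (T ^^ (p + 1)) \<circ> S = T ^^ p"

definition drazin_range :: "nat \<Rightarrow> ('h \<Rightarrow> 'h) \<Rightarrow> 'h set" where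
  "drazin_range p T = range (T ^^ p)"

definition drazin_kernel :: "nat \<Rightarrow> ('h::zero \<Rightarrow> 'h) \<Rightarrow> 'h set" where
  "drazin_kernel p T = {x. (T ^^ p) x = 0}"

text \<open>\<open>X = A \<oplus> B\<close> as operators, relative to a direct sum decomposition into \<open>M\<close> and \<open>N\<close>.\<close>

definition is_direct_sum ::
    "'h::complex_hilbert_space set \<Rightarrow> 'h set \<Rightarrow> ('h \<Rightarrow> 'h) \<Rightarrow> ('h \<Rightarrow> 'h) \<Rightarrow> ('h \<Rightarrow> 'h) \<Rightarrow> bool" where
  "is_direct_sum M N X A B \<longleftrightarrow> (\<forall>x\<in>M. \<forall>y\<in>N. X (x + y) = A x + B y)"

text \<open>
  \<open>X = A \<oplus> B\<close> as sesquilinear forms: with \<open>V (x, y) = x + y\<close> from the Hilbert space direct sum of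
  \<open>M\<close> and \<open>N\<close> onto the whole space, \<open>V\<^sup>* X V = A \<oplus> B\<close>.  If \<open>M\<close> and \<open>N\<close> are orthogonal, then \<open>V\<close> is
  unitary and this is the same as \<open>is_direct_sum\<close>.  For a merely topological (oblique) direct
  sum, \<open>V\<close> is only invertible; a positive \<open>X\<close> vanishing on \<open>N\<close> is then of the form
  \<open>A \<oplus> 0\<close> in this sense, but it need not map \<open>M\<close> into \<open>M\<close>.
\<close>

definition is_form_direct_sum ::
    "'h::complex_hilbert_space set \<Rightarrow> 'h set \<Rightarrow> ('h \<Rightarrow> 'h) \<Rightarrow> ('h \<Rightarrow> 'h) \<Rightarrow> ('h \<Rightarrow> 'h) \<Rightarrow> bool" where
  "is_form_direct_sum M N X A B \<longleftrightarrow>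
     (\<forall>x\<in>M. \<forall>y\<in>N. \<forall>u\<in>M. \<forall>v\<in>N.
        cinner (X (x + y)) (u + v) = cinner (A x) u + cinner (B y) v)"

definition orthogonal_subspaces :: "'h::complex_hilbert_space set \<Rightarrow> 'h set \<Rightarrow> bool" where
  "orthogonal_subspaces M N \<longleftrightarrow> (\<forall>x\<in>M. \<forall>y\<in>N. cinner x y = 0)"

end

theory Submission
  imports Defs
begin

text \<open>
  Everything happens at the level of the quadratic form \<open>q x = \<langle>P x, x\<rangle> \<ge> 0\<close>.  Moving the adjoints
  to the other side of the inner product, \<open>\<langle>\<triangle>\<^sup>m(P) x, x\<rangle>\<close> becomes the scalar alternating sum
  \<open>\<Sum>\<^sub>j (-1)\<^sup>j (m choose j) q (T\<^sup>j x)\<close> (lemma \<open>cinner_Delta\<close>), so all operator inequalities turn into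
  inequalities between numbers \<open>q (T\<^sup>j x)\<close> and \<open>q (T\<^sub>d\<^sup>j x)\<close>.

  If \<open>T\<close> is \<open>(m, P)\<close>-expansive, then \<open>q\<close> vanishes on \<open>ker (T\<^sup>p)\<close>: once \<open>q\<close> is known to vanish at
  \<open>T x, T\<^sup>2 x, \<dots>\<close>, only the term \<open>q x\<close> remains in the alternating sum, which makes it nonpositive
  (lemma \<open>form_zero_on_nilpotent_part\<close>).  By the Cauchy--Schwarz argument, \<open>P\<close> itself vanishes
  there.  For a positive operator, vanishing on \<open>H\<^sub>2\<close> is the same as being \<open>P\<^sub>1\<^sub>1 \<oplus> 0\<close>: as forms, the
  block \<open>P\<^sub>1\<^sub>1\<close> is the compression of \<open>P\<close> to the closed subspace \<open>H\<^sub>1\<close>, and when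
  \<open>H\<^sub>1 \<bottom> H\<^sub>2\<close> it is the restriction of \<open>P\<close>.

  If \<open>P\<close> vanishes on \<open>H\<^sub>2 = ker (T T\<^sub>d)\<close>, then \<open>q\<close> does not change under the idempotent
  \<open>T T\<^sub>d = T\<^sub>d T\<close>, so from the point of view of \<open>q\<close> the operators \<open>T\<close> and \<open>T\<^sub>d\<close> are inverse to each
  other.  Reading the alternating sum for \<open>T\<close> at \<open>x\<close> backwards gives, up to the sign \<open>(-1)\<^sup>m\<close>,
  the one for \<open>T\<^sub>d\<close> at \<open>T\<^sup>m x\<close> (lemma \<open>alt_sum_reverse\<close>).  This exchanges the two inequalities.
\<close>

section \<open>Riesz representation on a closed subspace\<close>

lemma linear_coeff_zero_if_quadratic_nonneg:
  fixes a b :: real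
  assumes "a \<ge> 0" and nonneg: "\<And>t. t\<^sup>2 * a + 2 * t * b \<ge> 0"
  shows "b = 0"
proof (rule ccontr)
  assume "b \<noteq> 0"
  \<comment> \<open>The minimum is at \<open>t = - b / a\<close>; using \<open>a + 1\<close> instead also covers \<open>a = 0\<close>.\<close>
  define s where "s = a + 1"
  have s: "s > 0" using assms by (simp add: s_def)
  have "(- b / s)\<^sup>2 * a + 2 * (- b / s) * b = b\<^sup>2 / s\<^sup>2 * (a - 2 * s)"
    using s by (simp add: field_simps power2_eq_square)
  moreover have "b\<^sup>2 / s\<^sup>2 * (a - 2 * s) < 0"
    using \<open>b \<noteq> 0\<close> s assms(1) by (intro mult_pos_neg) (auto simp: s_def)
  ultimately show False using nonneg[of "- b / s"] by linarith
qed

text \<open>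
  The representing vector is the minimiser on \<open>M\<close> of \<open>J x = \<parallel>x\<parallel>\<^sup>2 - 2 f x\<close>.  The parallelogram law
  makes minimising sequences Cauchy, and the first variation of \<open>J\<close> at the minimiser is the claim.
  With \<open>M = UNIV\<close> this yields adjoints; with \<open>f = inner y\<close> it yields the orthogonal projection of
  \<open>y\<close> onto \<open>M\<close>.
\<close>

lemma Riesz_on_closed_subspace:
  fixes f :: "'a::{real_inner, complete_space} \<Rightarrow> real"
  assumes f: "bounded_linear f" and M: "subspace M" and "closed M"
  obtains w where "w \<in> M" "\<And>x. x \<in> M \<Longrightarrow> f x = inner x w"
proof -
  interpret bounded_linear f by (rule f)
  obtain K where K: "\<And>x. norm (f x) \<le> norm x * K" using bounded by blast
  define J where "J x = (norm x)\<^sup>2 - 2 * f x" for x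
  define d where "d = Inf (J ` M)"
  have lower: "J x \<ge> - K\<^sup>2" for x
  proof -
    have "f x \<le> norm x * K" using K[of x] by simp
    moreover have "(norm x - K)\<^sup>2 \<ge> 0" by simp
    ultimately show ?thesis by (simp add: J_def power2_diff)
  qed
  have bdd: "bdd_below (J ` M)" using lower by (intro bdd_belowI[of _ "- K\<^sup>2"]) auto
  have ne: "J ` M \<noteq> {}" using subspace_0[OF M] by auto
  have d_le: "d \<le> J x" if "x \<in> M" for x
    unfolding d_def using bdd that by (auto intro: cInf_lower)
  have "\<exists>x\<in>M. J x < d + 1 / real (Suc n)" for n
    using cInf_lessD[OF ne, of "d + 1 / real (Suc n)"] by (auto simp: d_def)
  then obtain X where XM: "\<And>n. X n \<in> M" and XJ: "\<And>n. J (X n) < d + 1 / real (Suc n)"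
    by metis
  have close: "(norm (x - y))\<^sup>2 \<le> 2 * (J x - d) + 2 * (J y - d)" if "x \<in> M" "y \<in> M" for x y
  proof -
    define z where "z = (1/2) *\<^sub>R (x + y)"
    have "z \<in> M" using M that by (simp add: z_def subspace_add subspace_scale)
    have "(norm (x - y))\<^sup>2 = 2 * J x + 2 * J y - 4 * J z"
      by (simp add: J_def z_def power2_norm_eq_inner inner_simps inner_commute scaleR add
          algebra_simps)
    then show ?thesis using d_le[OF \<open>z \<in> M\<close>] by (simp add: algebra_simps)
  qed
  have "Cauchy X"
  proof (rule metric_CauchyI)
    fix e :: real assume e: "e > 0"
    obtain N where N: "1 / real (Suc N) < e\<^sup>2 / 4"
      using reals_Archimedean[of "e\<^sup>2 / 4"] e by (auto simp: inverse_eq_divide)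
    have "dist (X i) (X j) < e" if "i \<ge> N" "j \<ge> N" for i j
    proof -
      have "1 / real (Suc k) \<le> 1 / real (Suc N)" if "k \<ge> N" for k
        using that by (simp add: field_simps)
      then have "J (X i) - d < e\<^sup>2 / 4" "J (X j) - d < e\<^sup>2 / 4"
        using XJ[of i] XJ[of j] N that by fastforce+
      then have "2 * (J (X i) - d) + 2 * (J (X j) - d) < e\<^sup>2" by simp
      then have "(norm (X i - X j))\<^sup>2 < e\<^sup>2"
        using close[OF XM XM, of i j] by (rule le_less_trans[rotated])
      then show ?thesis using e by (simp add: dist_norm power2_less_imp_less)
    qed
    then show "\<exists>N. \<forall>i\<ge>N. \<forall>j\<ge>N. dist (X i) (X j) < e" by blast
  qed
  then obtain w where w: "X \<longlonglongrightarrow> w"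
    using Cauchy_convergent convergent_def by blast
  have wM: "w \<in> M" using \<open>closed M\<close> XM w closed_sequentially by blast
  have "(\<lambda>n. J (X n)) \<longlonglongrightarrow> J w"
    unfolding J_def by (intro tendsto_intros w tendsto)
  moreover have "(\<lambda>n. d + 1 / real (Suc n)) \<longlonglongrightarrow> d + 0"
    by (intro tendsto_intros LIMSEQ_Suc[OF lim_1_over_n])
  moreover have "\<exists>N. \<forall>n\<ge>N. J (X n) \<le> d + 1 / real (Suc n)"
    using XJ by (blast intro: less_imp_le)
  ultimately have "J w \<le> d + 0" by (rule LIMSEQ_le)
  then have Jw: "J w \<le> d" by simp
  have "f x = inner x w" if "x \<in> M" for x
  proof -
    have "inner w x - f x = 0"
    proof (rule linear_coeff_zero_if_quadratic_nonneg[of "(norm x)\<^sup>2"])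
      fix t
      have mem: "w + t *\<^sub>R x \<in> M" using M wM that by (simp add: subspace_add subspace_scale)
      have "J (w + t *\<^sub>R x) \<ge> J w" using d_le[OF mem] Jw by simp
      moreover have "J (w + t *\<^sub>R x) = J w + (t\<^sup>2 * (norm x)\<^sup>2 + 2 * t * (inner w x - f x))"
        by (simp add: J_def power2_norm_eq_inner inner_simps inner_commute scaleR add
          power2_eq_square[of t] algebra_simps)
      ultimately show "t\<^sup>2 * (norm x)\<^sup>2 + 2 * t * (inner w x - f x) \<ge> 0" by simp
    qed simp
    then show ?thesis by (simp add: inner_commute)
  qed
  with wM that show thesis by blast
qed

section \<open>The complex inner product and adjoints\<close>

lemma cinner_flip:
  fixes a b c d :: "'h::complex_hilbert_space"
  shows "cinner a b = cinner c d \<Longrightarrow> cinner b a = cinner d c"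
  by (simp only: cinner_commute[of b a] cinner_commute[of d c])

text \<open>
  The imaginary part of \<open>cinner x y\<close> is the real part of \<open>cinner (-\<i> x) y\<close>; hence identities
  between real inner products that are stable under complex scaling lift to complex ones.
\<close>

lemma cinner_eqI:
  fixes x y x' y' :: "'h::complex_hilbert_space"
  assumes "\<And>c. inner (c *\<^sub>C x) y = inner (c *\<^sub>C x') y'"
  shows "cinner x y = cinner x' y'"
proof (rule complex_eqI)
  show "Re (cinner x y) = Re (cinner x' y')"
    using assms[of 1] by (simp add: Re_cinner)
  have "Im (cinner a b) = inner ((- \<i>) *\<^sub>C a) b" for a b :: 'h
    by (simp only: Re_cinner[symmetric] cinner_scaleC_left) simp
  then show "Im (cinner x y) = Im (cinner x' y')" using assms by simp
qed

lemma cinner_add_right: "cinner x (y + z) = cinner x y + cinner (x::'h::complex_hilbert_space) z"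
  by (simp only: cinner_commute[of x] cinner_add_left complex_cnj_add)

lemma cinner_scaleC_right:
  "cinner x (c *\<^sub>C y) = cnj c * cinner (x::'h::complex_hilbert_space) y"
  by (simp only: cinner_commute[of x] cinner_scaleC_left complex_cnj_mult)

lemma cinner_scaleR_left:
  "cinner (r *\<^sub>R x) y = of_real r * cinner (x::'h::complex_hilbert_space) y"
  by (simp only: scaleC_of_real[symmetric] cinner_scaleC_left)

lemma cinner_zero_left [simp]: "cinner 0 (x::'h::complex_hilbert_space) = 0"
  using cinner_scaleR_left[of 0 0 x] by simp

lemma cinner_minus_left: "cinner (- x) y = - cinner (x::'h::complex_hilbert_space) y"
  using cinner_scaleR_left[of "-1" x y] by simp

lemma cinner_sum_left:
  "cinner (\<Sum>i\<in>A. f i) (y::'h::complex_hilbert_space) = (\<Sum>i\<in>A. cinner (f i) y)"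
  by (induction A rule: infinite_finite_induct) (simp_all add: cinner_add_left)

lemma eq_if_inner_eq_on_subspace:
  fixes a b :: "'a::real_inner"
  assumes "subspace M" "a \<in> M" "b \<in> M" "\<And>u. u \<in> M \<Longrightarrow> inner u a = inner u b"
  shows "a = b"
proof -
  have "a - b \<in> M" using assms by (simp add: subspace_diff)
  then have "inner (a - b) (a - b) = 0" using assms(4) by (simp add: inner_diff_right)
  then show ?thesis by simp
qed

lemma bounded_clinear_bounded_linear: "bounded_clinear T \<Longrightarrow> bounded_linear T"
  and bounded_clinear_scaleC: "bounded_clinear T \<Longrightarrow> T (c *\<^sub>C x) = c *\<^sub>C T x"
  by (simp_all add: bounded_clinear_def)

lemma bounded_clinear_linear: "bounded_clinear T \<Longrightarrow> linear T"
  by (intro bounded_linear.linear bounded_clinear_bounded_linear)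

lemma bounded_clinear_add: "bounded_clinear T \<Longrightarrow> T (x + y) = T x + T y"
  and bounded_clinear_diff: "bounded_clinear T \<Longrightarrow> T (x - y) = T x - T y"
  and bounded_clinear_zero: "bounded_clinear T \<Longrightarrow> T 0 = 0"
  and bounded_clinear_scaleR: "bounded_clinear T \<Longrightarrow> T (r *\<^sub>R x) = r *\<^sub>R T x"
  by (rule bounded_clinear_linear[THEN linear_add] bounded_clinear_linear[THEN linear_diff]
      bounded_clinear_linear[THEN linear_0] bounded_clinear_linear[THEN linear_scale], assumption)+

lemma cinner_cadjoint:
  fixes T :: "'h::complex_hilbert_space \<Rightarrow> 'h"
  assumes T: "bounded_clinear T"
  shows "cinner (cadjoint T y) x = cinner y (T x)"
proof -
  have "\<exists>w. \<forall>x. inner (T x) y = inner x w" for y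
  proof -
    have "bounded_linear (\<lambda>x. inner (T x) y)"
      using bounded_clinear_bounded_linear[OF T]
      by (rule bounded_linear_compose[OF bounded_linear_inner_left])
    then obtain w where "\<And>x. x \<in> UNIV \<Longrightarrow> inner (T x) y = inner x w"
      by (rule Riesz_on_closed_subspace[OF _ subspace_UNIV closed_UNIV]) (rule that)
    then show ?thesis by (intro exI[of _ w]) simp
  qed
  then obtain S where S: "\<And>x y. inner (T x) y = inner x (S y)" by metis
  have cS: "cinner (T x) y = cinner x (S y)" for x y
    by (rule cinner_eqI) (simp only: S[symmetric] bounded_clinear_scaleC[OF T])
  have "cadjoint T = S"
    unfolding cadjoint_def
  proof (rule the_equality)
    fix S' assume S': "\<forall>x y. cinner (T x) y = cinner x (S' y)"
    have "S' y = S y" for y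
    proof (rule eq_if_inner_eq_on_subspace[OF subspace_UNIV])
      fix u show "inner u (S' y) = inner u (S y)"
        using S'[rule_format, of u y] cS[of u y] by (simp only: Re_cinner[symmetric])
    qed simp_all
    then show "S' = S" by blast
  qed (simp add: cS)
  then show ?thesis using cinner_flip[OF cS[of x y]] by simp
qed

lemma cinner_cadjoint_funpow:
  assumes "bounded_clinear T"
  shows "cinner ((cadjoint T ^^ j) y) x = cinner y ((T ^^ j) x)"
  by (induction j arbitrary: x y) (simp_all add: cinner_cadjoint[OF assms] funpow_swap1)

section \<open>Positive operators\<close>

lemma positive_operator_bounded_clinear: "positive_operator P \<Longrightarrow> bounded_clinear P"
  by (simp add: positive_operator_def)

lemma positive_operator_form:
  assumes "positive_operator P"
  shows "cinner (P x) x = of_real (inner (P x) x)" and "inner (P x) x \<ge> 0"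
proof -
  have *: "cinner (P x) x \<in> \<real>" "0 \<le> Re (cinner (P x) x)"
    using assms by (simp_all add: positive_operator_def op_le_def)
  show "inner (P x) x \<ge> 0" using *(2) by (simp add: Re_cinner)
  show "cinner (P x) x = of_real (inner (P x) x)"
    using *(1) by (simp add: Re_cinner[symmetric])
qed

text \<open>
  On a complex space a real quadratic form comes from a Hermitian sesquilinear form: the
  diagonal values at \<open>x + y\<close> and \<open>x + \<i> y\<close> control the imaginary and the real part of
  \<open>\<langle>P x, y\<rangle> - \<langle>x, P y\<rangle>\<close>.
\<close>

lemma positive_operator_selfadjoint:
  fixes P :: "'h::complex_hilbert_space \<Rightarrow> 'h"
  assumes P: "positive_operator P"
  shows "cinner (P x) y = cinner x (P y)"
proof -
  note lin = bounded_clinear_add[OF positive_operator_bounded_clinear[OF P]]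
    bounded_clinear_scaleC[OF positive_operator_bounded_clinear[OF P]]
  have real: "Im (cinner (P z) z) = 0" for z
    using positive_operator_form(1)[OF P, of z] by simp
  have "Im (cinner (P x) y) + Im (cinner (P y) x) = 0"
    using real[of "x + y"] real[of x] real[of y]
    by (simp add: lin cinner_add_left cinner_add_right)
  moreover have "- Re (cinner (P x) y) + Re (cinner (P y) x) = 0"
    using real[of "x + \<i> *\<^sub>C y"] real[of x] real[of y]
    by (simp add: lin cinner_add_left cinner_add_right cinner_scaleC_left cinner_scaleC_right)
  ultimately have "cinner (P x) y = cnj (cinner (P y) x)"
    by (simp add: complex_eq_iff)
  then show ?thesis by (simp only: cinner_commute[of x])
qed

lemma positive_operator_inner_selfadjoint:
  "positive_operator P \<Longrightarrow> inner (P x) y = inner x (P y)"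
  by (simp only: Re_cinner[symmetric] positive_operator_selfadjoint)

text \<open>
  This is the equality case of Cauchy--Schwarz for the form \<open>\<langle>P x, y\<rangle>\<close>:  \<open>q (x + t y) \<ge> 0\<close> for all
  real \<open>t\<close> forces the linear coefficient \<open>\<langle>P x, y\<rangle>\<close> to vanish, for \<open>y = P x\<close> in particular.
\<close>

lemma positive_operator_zero_if_form_zero:
  assumes P: "positive_operator P" and "inner (P x) x = 0"
  shows "P x = 0"
proof -
  note lin = bounded_clinear_add[OF positive_operator_bounded_clinear[OF P]]
    bounded_clinear_scaleR[OF positive_operator_bounded_clinear[OF P]]
  define y where "y = P x"
  have "inner (P x) y = 0"
  proof (rule linear_coeff_zero_if_quadratic_nonneg)
    show "inner (P y) y \<ge> 0" using positive_operator_form(2)[OF P] .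
    fix t
    have "inner (P y) x = inner (P x) y"
      unfolding positive_operator_inner_selfadjoint[OF P, of y x] by (rule inner_commute)
    then have "inner (P (x + t *\<^sub>R y)) (x + t *\<^sub>R y) = t\<^sup>2 * inner (P y) y + 2 * t * inner (P x) y"
      using assms(2) by (simp add: lin inner_simps power2_eq_square algebra_simps)
    then show "0 \<le> t\<^sup>2 * inner (P y) y + 2 * t * inner (P x) y"
      using positive_operator_form(2)[OF P, of "x + t *\<^sub>R y"] by simp
  qed
  then show ?thesis by (simp add: y_def)
qed

section \<open>Alternating sums of the quadratic form\<close>

definition alt_sum :: "nat \<Rightarrow> ('a \<Rightarrow> 'a) \<Rightarrow> ('a \<Rightarrow> real) \<Rightarrow> 'a \<Rightarrow> real" where
  "alt_sum m S q x = (\<Sum>j\<le>m. (-1) ^ j * real (m choose j) * q ((S ^^ j) x))"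

lemma cinner_Delta:
  assumes "positive_operator P" "bounded_clinear S"
  shows "cinner (Delta m S P x) x = of_real (alt_sum m S (\<lambda>y. inner (P y) y) x)"
  by (simp add: Delta_def alt_sum_def cinner_sum_left cinner_scaleR_left
      cinner_cadjoint_funpow[OF assms(2)] positive_operator_form(1)[OF assms(1)])

lemma expansive_iff_alt_sum:
  assumes "positive_operator P" "bounded_clinear S"
  shows "expansive m P S \<longleftrightarrow> (\<forall>x. alt_sum m S (\<lambda>y. inner (P y) y) x \<le> 0)"
  by (simp add: expansive_def op_le_def cinner_minus_left cinner_Delta[OF assms])

lemma Delta_tilde_iff_alt_sum:
  assumes "positive_operator P" "bounded_clinear S"
  shows "op_le (Delta_tilde m S P) (\<lambda>_. 0)
    \<longleftrightarrow> (\<forall>x. (-1) ^ m * alt_sum m S (\<lambda>y. inner (P y) y) x \<le> 0)"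
proof -
  have "cinner (0 - Delta_tilde m S P x) x
      = of_real (- ((-1) ^ m * alt_sum m S (\<lambda>y. inner (P y) y) x))" for x
    by (simp add: Delta_tilde_def cinner_minus_left cinner_scaleR_left cinner_Delta[OF assms])
  then show ?thesis unfolding op_le_def by (simp only: Reals_of_real Re_complex_of_real) simp
qed

lemma funpow_zero:
  fixes S :: "'a::zero \<Rightarrow> 'a"
  shows "S 0 = 0 \<Longrightarrow> (S ^^ n) 0 = 0"
  by (induction n) simp_all

text \<open>
  Induction on the nilpotency exponent: by hypothesis \<open>q\<close> already vanishes at \<open>S\<^sup>j x\<close> for
  \<open>j \<ge> 1\<close>, so that the alternating sum at \<open>x\<close> is just its term \<open>q x\<close>.
\<close>

lemma form_zero_on_nilpotent_part:
  fixes q :: "'a::zero \<Rightarrow> real"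
  assumes nonneg: "\<And>x. q x \<ge> 0" and "q 0 = 0" and "S 0 = 0"
    and le: "\<And>x. alt_sum m S q x \<le> 0"
  shows "(S ^^ k) x = 0 \<Longrightarrow> q x = 0"
proof (induction k arbitrary: x)
  case 0
  then show ?case using \<open>q 0 = 0\<close> by simp
next
  case (Suc k)
  have zero: "q ((S ^^ Suc j) x) = 0" for j
  proof (rule Suc.IH)
    have "(S ^^ k) ((S ^^ Suc j) x) = (S ^^ j) ((S ^^ Suc k) x)"
      by (metis add.commute add_Suc_shift comp_apply funpow_add)
    then show "(S ^^ k) ((S ^^ Suc j) x) = 0"
      using Suc.prems funpow_zero[of S j] \<open>S 0 = 0\<close> by simp
  qed
  have "alt_sum m S q x = (\<Sum>j\<in>{0}. (-1) ^ j * real (m choose j) * q ((S ^^ j) x))"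
    unfolding alt_sum_def
  proof (rule sum.mono_neutral_right)
    show "\<forall>j\<in>{..m} - {0}. (-1) ^ j * real (m choose j) * q ((S ^^ j) x) = 0"
      using zero by (metis DiffD2 insertI1 mult_zero_right not0_implies_Suc)
  qed auto
  then show ?case using le[of x] nonneg[of x] by simp
qed

lemma commute_funpow:
  assumes "\<And>y. A (B y) = B (A y)"
  shows "A ((B ^^ i) y) = (B ^^ i) (A y)"
  by (induction i) (simp_all add: assms)

text \<open>
  Since \<open>q\<close> does not distinguish \<open>A (B y)\<close> from \<open>y\<close>, the values \<open>q (A\<^sup>j x)\<close> agree with
  \<open>q (B\<^sup>m\<^sup>-\<^sup>j w)\<close> for \<open>w = A\<^sup>m x\<close>; the symmetry \<open>j \<mapsto> m - j\<close> of the binomial coefficients then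
  reverses the sum.
\<close>

lemma alt_sum_reverse:
  assumes comm: "\<And>y. A (B y) = B (A y)" and inv: "\<And>y. q (A (B y)) = q y"
  shows "alt_sum m A q x = (-1) ^ m * alt_sum m B q ((A ^^ m) x)"
proof -
  have pow: "q ((B ^^ i) ((A ^^ i) y)) = q y" for i y
  proof (induction i)
    case (Suc i)
    have "(B ^^ Suc i) ((A ^^ Suc i) y) = B (A ((B ^^ i) ((A ^^ i) y)))"
      by (simp add: commute_funpow[of A B, OF comm])
    then show ?case using Suc inv comm by metis
  qed simp
  have q: "q ((B ^^ i) ((A ^^ m) x)) = q ((A ^^ (m - i)) x)" if "i \<le> m" for i
  proof -
    have "(A ^^ m) x = (A ^^ i) ((A ^^ (m - i)) x)"
      using that by (metis comp_apply funpow_add le_add_diff_inverse)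
    then show ?thesis by (simp add: pow)
  qed
  have sign: "(-1) ^ (m - i) = (-1) ^ m * ((-1) ^ i :: real)" if "i \<le> m" for i
    using that by (simp add: minus_one_power_iff)
  have "alt_sum m A q x = (\<Sum>i\<le>m. (-1) ^ (m - i) * real (m choose (m - i)) * q ((A ^^ (m - i)) x))"
    unfolding alt_sum_def
    by (rule sum.reindex_bij_witness[of _ "\<lambda>i. m - i" "\<lambda>i. m - i"]) auto
  also have "\<dots> = (\<Sum>i\<le>m. (-1) ^ m * ((-1) ^ i * real (m choose i) * q ((B ^^ i) ((A ^^ m) x))))"
    by (rule sum.cong) (simp_all add: q sign binomial_symmetric[symmetric])
  finally show ?thesis by (simp add: alt_sum_def sum_distrib_left)
qed

section \<open>The Drazin decomposition\<close>

lemma drazin_inverseD: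
  assumes "drazin_inverse p T S"
  shows "bounded_clinear T" "bounded_clinear S" "T (S x) = S (T x)" "S (S (T x)) = S x"
    "T (S ((T ^^ p) x)) = (T ^^ p) x" "p \<ge> 1"
proof -
  note d = assms[unfolded drazin_inverse_def]
  show "bounded_clinear T" "bounded_clinear S" "p \<ge> 1" using d by auto
  show comm: "T (S x) = S (T x)" for x using d by (metis comp_apply)
  have "((S ^^ 2) \<circ> T) x = S x" using d by simp
  then show "S (S (T x)) = S x" by (simp add: numeral_2_eq_2)
  have "((T ^^ (p + 1)) \<circ> S) x = (T ^^ p) x" using d by simp
  then show "T (S ((T ^^ p) x)) = (T ^^ p) x"
    by (simp add: commute_funpow[of S T, OF comm[symmetric]])
qed

text \<open>
  Idempotence of \<open>T S\<close> allows writing it as \<open>T\<^sup>n S\<^sup>n\<close>; for \<open>n = p\<close> this exhibits its values as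
  elements of the range of \<open>T\<^sup>p\<close>, and as zero on the kernel of \<open>T\<^sup>p\<close>.
\<close>

lemma drazin_projection_funpow:
  assumes d: "drazin_inverse p T S" and "n \<ge> 1"
  shows "T (S x) = (T ^^ n) ((S ^^ n) x)"
  using \<open>n \<ge> 1\<close>
proof (induction n rule: dec_induct)
  case (step n)
  have "(T ^^ Suc n) ((S ^^ Suc n) x) = T (S ((T ^^ n) ((S ^^ n) x)))"
    using commute_funpow[of S T n "(S ^^ n) x"] drazin_inverseD(3)[OF d] by simp
  also have "\<dots> = T (S (T (S x)))" using step.IH by simp
  also have "\<dots> = T (S x)"
    by (simp add: drazin_inverseD(3)[OF d] drazin_inverseD(4)[OF d])
  finally show ?case by simp
qed simp

text \<open>
  The idempotent \<open>T S\<close> is the oblique projection onto \<open>drazin_range\<close> along \<open>drazin_kernel\<close>.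
  Describing the range as the fixed points of a continuous map shows that it is closed, which
  is what the compression of \<open>P\<close> below requires.
\<close>

lemma drazin_range_eq_fixed_points:
  assumes d: "drazin_inverse p T S"
  shows "drazin_range p T = {x. T (S x) = x}"
proof safe
  fix x assume "x \<in> drazin_range p T"
  then show "T (S x) = x" using drazin_inverseD(5)[OF d] by (auto simp: drazin_range_def)
next
  fix x assume "T (S x) = x"
  then show "x \<in> drazin_range p T"
    using drazin_projection_funpow[OF d drazin_inverseD(6)[OF d], of x]
    unfolding drazin_range_def by (metis rangeI)
qed

lemma drazin_kernel_eq_kernel:
  assumes d: "drazin_inverse p T S"
  shows "drazin_kernel p T = {x. T (S x) = 0}"
proof -
  note comm = drazin_inverseD(3)[OF d]
  have z: "T 0 = 0" "S 0 = 0"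
    using d by (auto intro: bounded_clinear_zero drazin_inverseD)
  have swap: "(T ^^ p) ((S ^^ p) x) = (S ^^ p) ((T ^^ p) x)" for x
  proof -
    have "(T ^^ p) (S y) = S ((T ^^ p) y)" for y
      using commute_funpow[of S T p y] comm by simp
    then show ?thesis using commute_funpow[of "T ^^ p" S p x] by simp
  qed
  have pow: "T (S ((T ^^ p) x)) = (T ^^ p) (T (S x))" for x
    using commute_funpow[of "\<lambda>y. T (S y)" T p x] comm by simp
  show ?thesis
  proof safe
    fix x assume "x \<in> drazin_kernel p T"
    then show "T (S x) = 0"
      using drazin_projection_funpow[OF d drazin_inverseD(6)[OF d], of x] swap z
      by (simp add: drazin_kernel_def funpow_zero)
  next
    fix x assume "T (S x) = 0"
    then have "T (S ((T ^^ p) x)) = 0" using pow z by (simp add: funpow_zero)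
    then show "x \<in> drazin_kernel p T"
      using drazin_inverseD(5)[OF d] by (simp add: drazin_kernel_def)
  qed
qed

lemma drazin_splitting:
  assumes d: "drazin_inverse p T S"
  shows "T (S x) \<in> drazin_range p T" "x - T (S x) \<in> drazin_kernel p T"
proof -
  note lin = drazin_inverseD(1)[OF d] drazin_inverseD(2)[OF d]
  have "T (S (T (S x))) = T (S x)"
    by (simp add: drazin_inverseD(3)[OF d] drazin_inverseD(4)[OF d])
  then show "T (S x) \<in> drazin_range p T" "x - T (S x) \<in> drazin_kernel p T"
    by (simp_all add: drazin_range_eq_fixed_points[OF d] drazin_kernel_eq_kernel[OF d]
        bounded_clinear_diff[OF lin(1)] bounded_clinear_diff[OF lin(2)])
qed

lemma drazin_range_closed_subspace:
  assumes d: "drazin_inverse p T S"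
  shows "subspace (drazin_range p T)" "closed (drazin_range p T)"
    "x \<in> drazin_range p T \<Longrightarrow> c *\<^sub>C x \<in> drazin_range p T"
proof -
  note lin = drazin_inverseD(1)[OF d] drazin_inverseD(2)[OF d]
  note simps = drazin_range_eq_fixed_points[OF d]
  show "subspace (drazin_range p T)"
    unfolding simps
    by (rule subspaceI) (simp_all add: lin bounded_clinear_add bounded_clinear_scaleR
        bounded_clinear_zero)
  have "bounded_linear (\<lambda>x. T (S x))"
    using lin by (auto intro: bounded_linear_compose bounded_clinear_bounded_linear)
  then have "continuous_on UNIV (\<lambda>x. T (S x))" by (rule linear_continuous_on)
  then show "closed (drazin_range p T)"
    unfolding simps by (intro closed_Collect_eq continuous_on_id)
  show "x \<in> drazin_range p T \<Longrightarrow> c *\<^sub>C x \<in> drazin_range p T"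
    unfolding simps by (simp add: lin bounded_clinear_scaleC)
qed

section \<open>Positive operators vanishing on the kernel\<close>

text \<open>
  The compression to \<open>M\<close> sends \<open>x\<close> to the orthogonal projection of \<open>A x\<close> onto \<open>M\<close>; linearity
  and the norm bound follow from uniqueness of the representing vector.
\<close>

lemma compression_exists:
  fixes A :: "'h::complex_hilbert_space \<Rightarrow> 'h"
  assumes A: "bounded_clinear A" and M: "subspace M" "closed M"
    and M_scaleC: "\<And>c x. x \<in> M \<Longrightarrow> c *\<^sub>C x \<in> M"
  obtains B where "bounded_clinear_on M B"
    "\<And>x u. u \<in> M \<Longrightarrow> cinner (B x) u = cinner (A x) u"
proof -
  have "\<exists>w\<in>M. \<forall>u\<in>M. inner (A x) u = inner u w" for x
  proof -
    obtain w where "w \<in> M" "\<And>u. u \<in> M \<Longrightarrow> inner (A x) u = inner u w"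
      by (rule Riesz_on_closed_subspace[OF bounded_linear_inner_right M]) (rule that)
    then show ?thesis by blast
  qed
  then obtain B where BM: "\<And>x. B x \<in> M" and B: "\<And>x u. u \<in> M \<Longrightarrow> inner u (A x) = inner u (B x)"
    by (metis inner_commute)
  have cB: "cinner (B x) u = cinner (A x) u" if "u \<in> M" for x u
  proof -
    have "cinner u (B x) = cinner u (A x)"
      by (rule cinner_eqI) (simp add: B[symmetric] M_scaleC that)
    then show ?thesis by (rule cinner_flip)
  qed
  have uniq: "B x = w" if "w \<in> M" "\<And>u. u \<in> M \<Longrightarrow> cinner w u = cinner (A x) u" for x w
  proof (rule eq_if_inner_eq_on_subspace[OF M(1) BM that(1)])
    fix u assume u: "u \<in> M"
    then have "cinner (B x) u = cinner w u" using that(2) cB by simp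
    then show "inner u (B x) = inner u w"
      unfolding inner_commute[of u] by (simp only: Re_cinner[symmetric])
  qed
  have add: "B (x + y) = B x + B y" for x y
    by (rule uniq)
      (simp_all add: BM M(1) subspace_add cB cinner_add_left bounded_clinear_add[OF A])
  have scale: "B (c *\<^sub>C x) = c *\<^sub>C B x" for c x
    by (rule uniq) (simp_all add: BM M_scaleC cB cinner_scaleC_left bounded_clinear_scaleC[OF A])
  obtain K where K: "\<And>x. norm (A x) \<le> norm x * K"
    using bounded_linear.bounded[OF bounded_clinear_bounded_linear[OF A]] by blast
  have "norm (B x) \<le> K * norm x" for x
  proof -
    have "norm (B x) * norm (B x) = inner (B x) (A x)"
      by (simp add: B BM power2_norm_eq_inner[symmetric] power2_eq_square)
    also have "\<dots> \<le> norm (B x) * norm (A x)" by (rule norm_cauchy_schwarz)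
    finally have "norm (B x) \<le> norm (A x)" by (cases "B x = 0") auto
    then show ?thesis using K[of x] by (simp add: mult.commute)
  qed
  then have "bounded_clinear_on M B"
    unfolding bounded_clinear_on_def using BM add scale by blast
  with cB that show thesis by blast
qed

lemma form_direct_sum_iff_vanishing:
  fixes P :: "'h::complex_hilbert_space \<Rightarrow> 'h"
  assumes d: "drazin_inverse p T S" and P: "positive_operator P"
  defines "M \<equiv> drazin_range p T" and "N \<equiv> drazin_kernel p T"
  shows "(\<exists>A. bounded_clinear_on M A \<and> is_form_direct_sum M N P A (\<lambda>_. 0)) \<longleftrightarrow> (\<forall>y\<in>N. P y = 0)"
proof
  assume "\<exists>A. bounded_clinear_on M A \<and> is_form_direct_sum M N P A (\<lambda>_. 0)"
  then obtain A where A: "bounded_clinear_on M A" and sum: "is_form_direct_sum M N P A (\<lambda>_. 0)"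
    by blast
  have M0: "0 \<in> M"
    using subspace_0[OF drazin_range_closed_subspace(1)[OF d]] by (simp add: M_def)
  with A have "A (0 + 0) = A 0 + A 0" unfolding bounded_clinear_on_def by blast
  then have A0: "A 0 = 0" by simp
  show "\<forall>y\<in>N. P y = 0"
  proof
    fix y assume y: "y \<in> N"
    \<comment> \<open>For a positive operator, a vanishing diagonal value \<open>\<langle>P y, y\<rangle>\<close> already forces \<open>P y = 0\<close>.\<close>
    have "cinner (P (0 + y)) (0 + y) = cinner (A 0) 0 + cinner 0 y"
      using sum M0 y unfolding is_form_direct_sum_def by blast
    then have "inner (P y) y = 0" using A0 by (simp add: Re_cinner[symmetric])
    then show "P y = 0" by (rule positive_operator_zero_if_form_zero[OF P])
  qed
next
  assume zero: "\<forall>y\<in>N. P y = 0"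
  obtain A where A: "bounded_clinear_on M A" "\<And>x u. u \<in> M \<Longrightarrow> cinner (A x) u = cinner (P x) u"
    using compression_exists[OF positive_operator_bounded_clinear[OF P]]
      drazin_range_closed_subspace[OF d] unfolding M_def by metis
  have "cinner (P (x + y)) (u + v) = cinner (A x) u + cinner 0 v"
    if "y \<in> N" "u \<in> M" "v \<in> N" for x y u v
  proof -
    have "cinner (P x) v = cinner x (P v)" by (rule positive_operator_selfadjoint[OF P])
    also have "\<dots> = 0"
      using zero that cinner_commute[of x 0] by simp
    finally show ?thesis
      using zero that A(2)
      by (simp add: bounded_clinear_add[OF positive_operator_bounded_clinear[OF P]]
          cinner_add_right)
  qed
  with A(1) show "\<exists>A. bounded_clinear_on M A \<and> is_form_direct_sum M N P A (\<lambda>_. 0)"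
    unfolding is_form_direct_sum_def by blast
qed

text \<open>
  For orthogonal summands the restriction of \<open>P\<close> is the required block: \<open>P x\<close> is orthogonal to
  \<open>H\<^sub>2\<close> by self-adjointness, so its component in \<open>H\<^sub>2\<close> is orthogonal to itself.
\<close>

lemma direct_sum_iff_vanishing:
  fixes P :: "'h::complex_hilbert_space \<Rightarrow> 'h"
  assumes d: "drazin_inverse p T S" and P: "positive_operator P"
  defines "M \<equiv> drazin_range p T" and "N \<equiv> drazin_kernel p T"
  assumes orth: "orthogonal_subspaces M N"
  shows "(\<exists>A. bounded_clinear_on M A \<and> is_direct_sum M N P A (\<lambda>_. 0)) \<longleftrightarrow> (\<forall>y\<in>N. P y = 0)"
proof
  assume "\<exists>A. bounded_clinear_on M A \<and> is_direct_sum M N P A (\<lambda>_. 0)"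
  then obtain A where A: "bounded_clinear_on M A" and sum: "is_direct_sum M N P A (\<lambda>_. 0)"
    by blast
  have M0: "0 \<in> M"
    using subspace_0[OF drazin_range_closed_subspace(1)[OF d]] by (simp add: M_def)
  with A have "A (0 + 0) = A 0 + A 0" unfolding bounded_clinear_on_def by blast
  then have A0: "A 0 = 0" by simp
  show "\<forall>y\<in>N. P y = 0"
  proof
    fix y assume "y \<in> N"
    then have "P (0 + y) = A 0 + 0" using sum M0 unfolding is_direct_sum_def by blast
    then show "P y = 0" using A0 by simp
  qed
next
  assume zero: "\<forall>y\<in>N. P y = 0"
  have lin: "bounded_clinear P" by (rule positive_operator_bounded_clinear[OF P])
  have "P x \<in> M" for x
  proof -
    define v where "v = P x - T (S (P x))"
    have v: "v \<in> N" and u: "T (S (P x)) \<in> M"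
      using drazin_splitting[OF d] by (simp_all add: v_def M_def N_def)
    have "inner (P x) v = inner x (P v)" by (rule positive_operator_inner_selfadjoint[OF P])
    also have "\<dots> = 0" using zero v by simp
    finally have "inner (P x) v = 0" .
    moreover have "inner (T (S (P x))) v = 0"
      using orth u v unfolding orthogonal_subspaces_def Re_cinner[symmetric] by simp
    ultimately have "inner v v = 0"
      by (subst v_def) (simp add: inner_diff_left)
    then have "P x = T (S (P x))" by (simp add: v_def)
    then show ?thesis using u by simp
  qed
  moreover obtain K where "\<And>x. norm (P x) \<le> norm x * K"
    using bounded_linear.bounded[OF bounded_clinear_bounded_linear[OF lin]] by blast
  then have "\<forall>x\<in>M. norm (P x) \<le> K * norm x" by (simp add: mult.commute)
  ultimately have "bounded_clinear_on M P"
    unfolding bounded_clinear_on_def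
    using bounded_clinear_add[OF lin] bounded_clinear_scaleC[OF lin] by blast
  moreover have "is_direct_sum M N P P (\<lambda>_. 0)"
    unfolding is_direct_sum_def using zero by (simp add: bounded_clinear_add[OF lin])
  ultimately show "\<exists>A. bounded_clinear_on M A \<and> is_direct_sum M N P A (\<lambda>_. 0)" by blast
qed

lemma form_invariant_under_drazin_projection:
  assumes d: "drazin_inverse p T S" and P: "positive_operator P"
    and zero: "\<forall>y\<in>drazin_kernel p T. P y = 0"
  shows "inner (P (T (S y))) (T (S y)) = inner (P y) y"
proof -
  have "P (y - T (S y)) = 0" using zero drazin_splitting(2)[OF d] by blast
  then have eq: "P (T (S y)) = P y"
    by (simp add: bounded_clinear_diff[OF positive_operator_bounded_clinear[OF P]])
  have "inner (P y) (T (S y)) = inner y (P (T (S y)))"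
    by (rule positive_operator_inner_selfadjoint[OF P])
  then show ?thesis by (simp add: eq inner_commute)
qed

section \<open>Expansive Drazin invertible operators\<close>

lemma expansive_iff_vanishing_and_Delta_tilde:
  fixes T S P :: "'h::complex_hilbert_space \<Rightarrow> 'h"
  assumes d: "drazin_inverse p T S" and P: "positive_operator P"
  shows "expansive m P T \<longleftrightarrow>
    (\<forall>y\<in>drazin_kernel p T. P y = 0) \<and> op_le (Delta_tilde m S P) (\<lambda>_. 0)"
proof -
  define q where "q = (\<lambda>x. inner (P x) x)"
  note T = drazin_inverseD(1)[OF d] and S = drazin_inverseD(2)[OF d]
    and comm = drazin_inverseD(3)[OF d]
  have exp: "expansive m P T \<longleftrightarrow> (\<forall>x. alt_sum m T q x \<le> 0)"
    using expansive_iff_alt_sum[OF P T] by (simp add: q_def)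
  have tilde: "op_le (Delta_tilde m S P) (\<lambda>_. 0) \<longleftrightarrow> (\<forall>x. (-1) ^ m * alt_sum m S q x \<le> 0)"
    using Delta_tilde_iff_alt_sum[OF P S] by (simp add: q_def)
  have vanish: "\<forall>y\<in>drazin_kernel p T. P y = 0" if le: "\<forall>x. alt_sum m T q x \<le> 0"
  proof
    fix y assume "y \<in> drazin_kernel p T"
    then have "(T ^^ p) y = 0" by (simp add: drazin_kernel_def)
    then have "q y = 0"
      using form_zero_on_nilpotent_part[of q T m p y] le positive_operator_form(2)[OF P]
        bounded_clinear_zero[OF T] by (simp add: q_def)
    then show "P y = 0" using positive_operator_zero_if_form_zero[OF P] by (simp add: q_def)
  qed
  have equiv: "(\<forall>x. alt_sum m T q x \<le> 0) \<longleftrightarrow> (\<forall>x. (-1) ^ m * alt_sum m S q x \<le> 0)"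
    if zero: "\<forall>y\<in>drazin_kernel p T. P y = 0"
  proof -
    have inv: "q (T (S y)) = q y" for y
      using form_invariant_under_drazin_projection[OF d P zero] by (simp add: q_def)
    have "alt_sum m T q x = (-1) ^ m * alt_sum m S q ((T ^^ m) x)" for x
      by (rule alt_sum_reverse) (rule comm inv)+
    moreover have "alt_sum m S q x = (-1) ^ m * alt_sum m T q ((S ^^ m) x)" for x
      by (rule alt_sum_reverse) (simp_all add: comm[symmetric] inv)
    then have "(-1) ^ m * alt_sum m S q x = alt_sum m T q ((S ^^ m) x)" for x
      by (simp flip: power_mult_distrib mult.assoc)
    ultimately show ?thesis by metis
  qed
  show ?thesis using exp tilde vanish equiv by blast
qed

theorem theorem2p3:
  fixes T Td P :: "'h::complex_hilbert_space \<Rightarrow> 'h" and H1 H2 :: "'h set" and m p :: nat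
  assumes separable: "separable_space (euclidean :: 'h topology)"
    and infinite_dim: "\<not> (\<exists>B :: 'h set. finite B \<and> complex_vector.span B = UNIV)"
    and m: "m \<ge> 1"
    and drazin: "drazin_inverse p T Td"
    and H1: "H1 = drazin_range p T"
    and H2: "H2 = drazin_kernel p T"
    and P: "positive_operator P"
  shows "(orthogonal_subspaces H1 H2 \<longrightarrow>
            (expansive m P T \<longleftrightarrow>
              (\<exists>P11. bounded_clinear_on H1 P11 \<and> is_direct_sum H1 H2 P P11 (\<lambda>_. 0)) \<and>
              op_le (Delta_tilde m Td P) (\<lambda>_. 0))) \<and>
         (expansive m P T \<longleftrightarrow>
           (\<exists>P11. bounded_clinear_on H1 P11 \<and> is_form_direct_sum H1 H2 P P11 (\<lambda>_. 0)) \<and>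
           op_le (Delta_tilde m Td P) (\<lambda>_. 0))"
  unfolding H1 H2
  using expansive_iff_vanishing_and_Delta_tilde[OF drazin P]
    form_direct_sum_iff_vanishing[OF drazin P] direct_sum_iff_vanishing[OF drazin P]
  by blast

end
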